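(* (i) Let $\Phi(x,y)\in\mathbb{C}[x,y]$ be a standard polynomial. If $\Phi(x,y)=f(y-x)$ for some univariate polynomial $f(s)\in\mathbb{C}[s]$, then $G(\Phi)$ is a Cayley digraph on the group $(\mathbb{C},+)$, i.e. $G(\Phi)=\mathrm{Cay}(\mathbb{C},S)$ for some finite nonempty $S\subset\mathbb{C}$ with $0\notin S$. (ii) Let $D=\mathrm{Cay}(\mathbb{C},S)$ be a Cayley digraph on $(\mathbb{C},+)$, where $S\subset\mathbb{C}$ is finite and nonempty with $0\notin S$. Then there exists a univariate polynomial $f(s)\in\mathbb{C}[s]$ such that $\Phi(x,y)=f(y-x)$ is a standard polynomial and $D$ is isomorphic to $G(\Phi)$.
   Context: Digraphs may be infinite and may have loops and multiple arcs. For $\Phi(x,y)\in\mathbb{C}[x,y]$, the digraph $G(\Phi)$ has vertex set $\mathbb{C}$, and $(u,v)$ is an arc of multiplicity $m\ge1$ if $v$ is a root of multiplicity $m$ of $\Phi(u,y)$ (if $\Phi(u,y)$ is the zero polynomial, every $(u,v)$ is an arc of multiplicity $1$). Write $\Phi(x,y)=\sum_{i=0}^d a_i(x)y^i=\sum_{j=0}^e b_j(y)x^j$ with $a_d,b_e\neq 0$, and set $A(x)=\gcd(a_0,\dots,a_d)$, $B(y)=\gcd(b_0,\dots,b_e)$, $D(x)=\mathrm{Resultant}(\Phi,\Phi'_y,y)$, $E(y)=\mathrm{Resultant}(\Phi,\Phi'_x,x)$, $L(x)=\Phi(x,x)$, where $\Phi'_x,\Phi'_y$ are the partial derivatives. $\Phi$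 is standard if it is non-constant, $A$ and $B$ are constant, and none of $D$, $E$, $L$ is the zero polynomial (non-vanishing of $D$ and $E$ means that $\Phi$ has no repeated non-constant factor). For a group $\Gamma$ and a finite nonempty set $S\subseteq\Gamma$ not containing the identity, the Cayley digraph $\mathrm{Cay}(\Gamma,S)$ has vertex set $\Gamma$, and $(u,v)$ is an arc (of multiplicity $1$) if and only if $v=su$ for some $s\in S$ (in additive notation $v=s+u$). $S$ is not required to generate $\Gamma$. *)

theory Defs
  imports
    "HOL-Computational_Algebra.Computational_Algebra"
    "HOL-Computational_Algebra.Field_as_Ring"
    Subresultants.Resultant_Prelim
    Graph_Theory.Digraph_Isomorphism
begin

text \<open>
  A polynomial \<open>\<Phi>(x,y)\<close> over the complex numbers is a \<^typ>\<open>complex poly poly\<close>: the outer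
  variable is \<open>y\<close>, and the coefficients \<open>coeff \<Phi> i = a\<^sub>i(x)\<close> are polynomials in \<open>x\<close>.
\<close>

text \<open>\<open>\<Phi>\<close> rewritten as a polynomial in \<open>x\<close> with coefficients \<open>b\<^sub>j(y)\<close>.\<close>

definition swap_vars :: "complex poly poly \<Rightarrow> complex poly poly" where
  "swap_vars \<Phi> = (\<Sum>i\<le>degree \<Phi>. map_poly (\<lambda>c. monom c i) (coeff \<Phi> i))"

lemma coeff_swap_vars: "coeff (coeff (swap_vars \<Phi>) j) i = coeff (coeff \<Phi> i) j"
proof -
  have "coeff (coeff (swap_vars \<Phi>) j) i
      = (\<Sum>k\<le>degree \<Phi>. if k = i then coeff (coeff \<Phi> i) j else 0)"
    unfolding swap_vars_def coeff_sum
    by (intro sum.cong refl) (auto simp: coeff_map_poly)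
  also have "\<dots> = coeff (coeff \<Phi> i) j"
    by (auto simp: coeff_eq_0)
  finally show ?thesis .
qed

text \<open>The univariate polynomial \<open>\<Phi>(u,y)\<close> in \<open>y\<close>.\<close>

definition specialize_x :: "complex poly poly \<Rightarrow> complex \<Rightarrow> complex poly" where
  "specialize_x \<Phi> u = map_poly (\<lambda>a. poly a u) \<Phi>"

definition arc_mult :: "complex poly poly \<Rightarrow> complex \<Rightarrow> complex \<Rightarrow> nat" where
  "arc_mult \<Phi> u v =
     (if specialize_x \<Phi> u = 0 then 1 else order v (specialize_x \<Phi> u))"

text \<open>
  An arc of multiplicity \<open>m\<close> from \<open>u\<close> to \<open>v\<close> is represented by the \<open>m\<close> parallel arcs
  \<open>(u, v, 0), \<dots>, (u, v, m - 1)\<close>. Digraphs whose arcs are all named in this way are equal if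
  and only if they have the same vertices and the same arc multiplicities.
\<close>

definition poly_digraph ::
    "complex poly poly \<Rightarrow> (complex, complex \<times> complex \<times> nat) pre_digraph" where
  "poly_digraph \<Phi> =
     \<lparr>verts = UNIV, arcs = {(u, v, k). k < arc_mult \<Phi> u v},
      tail = (\<lambda>(u, v, k). u), head = (\<lambda>(u, v, k). v)\<rparr>"

definition cayley_digraph ::
    "'a::group_add set \<Rightarrow> ('a, 'a \<times> 'a \<times> nat) pre_digraph" where
  "cayley_digraph S =
     \<lparr>verts = UNIV, arcs = {(u, v, k). (\<exists>s\<in>S. v = s + u) \<and> k = 0},
      tail = (\<lambda>(u, v, k). u), head = (\<lambda>(u, v, k). v)\<rparr>"

text \<open>
  The conjuncts: \<open>\<Phi>\<close> is non-constant; \<open>A(x)\<close> and \<open>B(y)\<close> are constant (\<^const>\<open>content\<close> is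
  the gcd of the coefficients); \<open>D(x)\<close>, \<open>E(y)\<close> and \<open>L(x) = \<Phi>(x,x)\<close> are not zero. By
  \<open>coeff_swap_vars\<close>, \<open>pderiv (swap_vars \<Phi>)\<close> is the partial derivative of \<open>\<Phi>\<close> with respect
  to \<open>x\<close>, in the swapped representation.
\<close>

definition standard_poly :: "complex poly poly \<Rightarrow> bool" where
  "standard_poly \<Phi> \<longleftrightarrow>
     (\<nexists>c. \<Phi> = [:[:c:]:]) \<and>
     degree (content \<Phi>) = 0 \<and>
     degree (content (swap_vars \<Phi>)) = 0 \<and>
     resultant \<Phi> (pderiv \<Phi>) \<noteq> 0 \<and>
     resultant (swap_vars \<Phi>) (pderiv (swap_vars \<Phi>)) \<noteq> 0 \<and>
     poly \<Phi> [:0, 1:] \<noteq> 0"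

text \<open>\<open>f(y - x)\<close>, where \<open>[:[:0, -1:], 1:]\<close> is \<open>y - x\<close>.\<close>

definition diff_poly :: "complex poly \<Rightarrow> complex poly poly" where
  "diff_poly f = pcompose (map_poly (\<lambda>c. [:c:]) f) [:[:0, -1:], 1:]"

end

theory Submission
  imports Defs Subresultants.Subresultant_Gcd
begin

text \<open>
  For fixed \<open>u\<close>, the polynomial \<open>f(y - u)\<close> is a translate of \<open>f\<close>, so the arcs leaving \<open>u\<close> in
  the digraph of \<open>f(y - x)\<close> end at \<open>u + s\<close> for the roots \<open>s\<close> of \<open>f\<close>, with the multiplicity of
  \<open>s\<close>. If the roots of \<open>f\<close> are simple, this is the Cayley digraph of the root set
  (\<open>poly_digraph_diff_poly\<close>).

  Both halves then follow from a description of standardness in terms of \<open>f\<close>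
  (\<open>standard_diff_poly_iff\<close>): \<open>f(y - x)\<close> is standard if and only if \<open>f\<close> is non-constant, has only
  simple roots and does not vanish at \<open>0\<close>. For \<open>f \<noteq> 0\<close> both contents are constant, because
  the leading coefficients in \<open>y\<close> and in \<open>x\<close> are constants. The value at \<open>u\<close> of the resultant with
  respect to \<open>y\<close> is the resultant of a translate of \<open>f\<close> and its derivative, hence non-zero exactly
  if \<open>f\<close> has simple roots; exchanging the variables replaces \<open>f(s)\<close> by \<open>f(-s)\<close>, which
  has simple roots if and only if \<open>f(s)\<close> does. On the diagonal the polynomial is the constant
  \<open>f(0)\<close>. In the first half the connection set is the root set of \<open>f\<close>; in the second half,
  \<open>f(t)\<close> is the product of the factors \<open>t - s\<close> over \<open>s \<in> S\<close>.
\<close>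

section \<open>Evaluation of bivariate polynomials\<close>

lemma poly_specialize_x: "poly (specialize_x \<Phi> u) v = poly (poly \<Phi> [:v:]) u"
proof (induction \<Phi>)
  case 0
  then show ?case by (simp add: specialize_x_def)
next
  case (pCons a p)
  then show ?case by (simp add: specialize_x_def map_poly_pCons)
qed

text \<open>
  Through this criterion, identities between bivariate polynomials, in particular those involving
  the exchange of variables, reduce to identities between values.
\<close>

lemma bivariate_poly_eqI:
  fixes p q :: "complex poly poly"
  assumes "\<And>u v. poly (poly p [:v:]) u = poly (poly q [:v:]) u"
  shows "p = q"
proof (rule poly_eqI)
  fix n
  have "specialize_x p u = specialize_x q u" for u
    by (rule poly_eq_poly_eq_iff[THEN iffD1]) (simp add: fun_eq_iff poly_specialize_x assms)
  hence "coeff (specialize_x p u) n = coeff (specialize_x q u) n" for u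
    by simp
  hence "poly (coeff p n) u = poly (coeff q n) u" for u
    by (simp add: specialize_x_def coeff_map_poly)
  thus "coeff p n = coeff q n"
    by (simp add: poly_eq_poly_eq_iff[symmetric] fun_eq_iff)
qed

lemma poly_swap_vars: "poly (poly (swap_vars \<Phi>) [:u:]) v = poly (poly \<Phi> [:v:]) u"
proof -
  have term_eq: "poly (poly (map_poly (\<lambda>c. monom c i) a) [:u:]) v = poly a u * v ^ i"
    for a :: "complex poly" and i
    by (induction a) (simp_all add: map_poly_pCons poly_monom algebra_simps)
  have "poly (poly (swap_vars \<Phi>) [:u:]) v = (\<Sum>i\<le>degree \<Phi>. poly (coeff \<Phi> i) u * v ^ i)"
    by (simp add: swap_vars_def poly_sum term_eq)
  also have "\<dots> = poly (poly \<Phi> [:v:]) u"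
    by (simp add: poly_altdef[of \<Phi>] poly_sum)
  finally show ?thesis .
qed

section \<open>Polynomials in the difference of the variables\<close>

lemma poly_diff_poly: "poly (diff_poly f) c = pcompose f (c - [:0, 1:])"
proof -
  have "poly (map_poly (\<lambda>c. [:c:]) f) q = pcompose f q" for q :: "complex poly"
    by (induction f) (simp_all add: map_poly_pCons pcompose_pCons)
  moreover have "[:0, -1:] = - [:0, 1 :: complex:]"
    by (simp only: minus_pCons minus_zero)
  hence "poly [:[:0, -1:], 1:] c = c - [:0, 1:]"
    by (simp del: minus_pCons)
  ultimately show ?thesis
    by (simp only: diff_poly_def poly_pcompose)
qed

lemma specialize_x_diff_poly: "specialize_x (diff_poly f) u = pcompose f [:-u, 1:]"
  by (rule poly_eq_poly_eq_iff[THEN iffD1])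
     (simp add: fun_eq_iff poly_specialize_x poly_diff_poly poly_pcompose algebra_simps)

lemma degree_diff_poly: "degree (diff_poly f) = degree f"
  by (simp add: diff_poly_def degree_pcompose degree_map_poly)

lemma swap_vars_diff_poly: "swap_vars (diff_poly f) = diff_poly (pcompose f [:0, -1:])"
  by (rule bivariate_poly_eqI)
     (simp add: poly_swap_vars poly_diff_poly poly_pcompose algebra_simps)

lemma lead_coeff_diff_poly: "lead_coeff (diff_poly f) = [:lead_coeff f:]"
  unfolding diff_poly_def by (subst lead_coeff_comp) (simp_all add: degree_map_poly coeff_map_poly)

text \<open>The gcd of the coefficients divides the leading one, which is a non-zero constant.\<close>

lemma degree_content_diff_poly:
  assumes "f \<noteq> 0"
  shows "degree (content (diff_poly f)) = 0"
proof -
  have "content (diff_poly f) dvd [:lead_coeff f:]"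
    using content_dvd_coeff[of "diff_poly f"] lead_coeff_diff_poly[of f] by metis
  hence "degree (content (diff_poly f)) \<le> degree [:lead_coeff f:]"
    using assms by (intro dvd_imp_degree_le) auto
  thus ?thesis by simp
qed

section \<open>Simple roots and resultants\<close>

text \<open>
  The resultant vanishes if and only if \<open>g\<close> and its derivative have a non-constant common divisor.
  Over an algebraically closed field this amounts to a common root, that is, a multiple root of
  \<open>g\<close>. For \<open>g = 0\<close> the equivalence fails: both degrees are then zero, so the Sylvester matrix is
  empty and the resultant is \<open>1\<close>.
\<close>

lemma resultant_pderiv_nonzero_iff:
  fixes g :: "complex poly"
  assumes "g \<noteq> 0"
  shows "resultant g (pderiv g) \<noteq> 0 \<longleftrightarrow> rsquarefree g"
proof -
  have "degree (gcd g (pderiv g)) \<noteq> 0 \<longleftrightarrow> (\<exists>a. poly (gcd g (pderiv g)) a = 0)"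
  proof
    assume "degree (gcd g (pderiv g)) \<noteq> 0"
    thus "\<exists>a. poly (gcd g (pderiv g)) a = 0"
      using fundamental_theorem_of_algebra[of "gcd g (pderiv g)"] by (metis constant_degree)
  next
    assume "\<exists>a. poly (gcd g (pderiv g)) a = 0"
    then obtain a where "[:-a, 1:] dvd gcd g (pderiv g)"
      by (auto simp: poly_eq_0_iff_dvd)
    hence "degree [:-a, 1:] \<le> degree (gcd g (pderiv g))"
      using assms by (intro dvd_imp_degree_le) auto
    thus "degree (gcd g (pderiv g)) \<noteq> 0" by simp
  qed
  also have "\<dots> \<longleftrightarrow> (\<exists>a. poly g a = 0 \<and> poly (pderiv g) a = 0)"
    by (simp add: poly_eq_0_iff_dvd)
  finally show ?thesis
    by (simp add: resultant_0_gcd rsquarefree_roots)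
qed

lemma rsquarefree_pcompose_linear_iff:
  fixes f :: "complex poly"
  assumes "b \<noteq> 0"
  shows "rsquarefree (pcompose f [:a, b:]) \<longleftrightarrow> rsquarefree f"
proof -
  have all_iff: "(\<forall>z. P (a + b * z)) \<longleftrightarrow> (\<forall>w. P w)" for P :: "complex \<Rightarrow> bool"
  proof
    assume "\<forall>z. P (a + b * z)"
    hence "P (a + b * ((w - a) / b))" for w ..
    thus "\<forall>w. P w"
      using assms by simp
  qed auto
  from all_iff[of "\<lambda>w. \<not> (poly f w = 0 \<and> poly (pderiv f) w = 0)"] show ?thesis
    using assms
    by (simp add: rsquarefree_roots pderiv_pcompose poly_pcompose pderiv_pCons mult.commute)
qed

text \<open>
  A resultant commutes with a specialisation that preserves the degrees of both polynomials. Setting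
  \<open>x = u\<close> does so here because the leading coefficients in \<open>y\<close> are constants. Thus a
  statement about polynomials over \<open>\<complex>[x]\<close> becomes one about univariate polynomials.
\<close>

lemma poly_resultant_diff_poly:
  fixes f :: "complex poly"
  defines "g \<equiv> \<lambda>u. pcompose f [:-u, 1:]"
  shows "poly (resultant (diff_poly f) (pderiv (diff_poly f))) u = resultant (g u) (pderiv (g u))"
proof -
  have g: "map_poly (\<lambda>c. poly c u) (diff_poly f) = g u"
    using specialize_x_diff_poly by (simp add: specialize_x_def g_def)
  have g': "map_poly (\<lambda>c. poly c u) (pderiv (diff_poly f)) = pderiv (g u)"
    unfolding g[symmetric]
    by (rule poly_eqI) (simp add: coeff_map_poly coeff_pderiv)
  have "degree (pderiv (g u)) = degree (pderiv (diff_poly f))"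
    by (simp add: degree_pderiv degree_diff_poly g_def degree_pcompose)
  thus ?thesis
    using poly_hom.resultant_map_poly[of u "diff_poly f" "pderiv (diff_poly f)"]
    by (simp add: g g' degree_diff_poly g_def degree_pcompose)
qed

lemma resultant_diff_poly_nonzero_iff:
  assumes "f \<noteq> 0"
  shows "resultant (diff_poly f) (pderiv (diff_poly f)) \<noteq> 0 \<longleftrightarrow> rsquarefree f"
proof -
  have "poly (resultant (diff_poly f) (pderiv (diff_poly f))) u \<noteq> 0 \<longleftrightarrow> rsquarefree f" for u
    using assms
    by (simp add: poly_resultant_diff_poly resultant_pderiv_nonzero_iff pcompose_eq_0_iff
        rsquarefree_pcompose_linear_iff[of 1, simplified])
  thus ?thesis
    by (metis poly_0 poly_all_0_iff_0)
qed

text \<open>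
  The second content and the second resultant reduce to the first ones, since exchanging
  the variables in \<open>f(y - x)\<close> gives \<open>g(y - x)\<close> with \<open>g(s) = f(-s)\<close>.
\<close>

lemma standard_diff_poly_iff:
  "standard_poly (diff_poly f) \<longleftrightarrow> degree f > 0 \<and> rsquarefree f \<and> poly f 0 \<noteq> 0"
proof (cases "degree f = 0")
  case True
  then obtain c where "f = [:c:]"
    by (metis degree_eq_zeroE)
  hence "diff_poly f = [:[:c:]:]"
    by (intro bivariate_poly_eqI) (simp add: poly_diff_poly)
  thus ?thesis
    using True by (auto simp: standard_poly_def)
next
  case False
  define g where "g = pcompose f [:0, -1:]"
  have nonzero: "f \<noteq> 0" "g \<noteq> 0"
    using False by (auto simp: g_def pcompose_eq_0_iff)
  have "\<nexists>c. diff_poly f = [:[:c:]:]"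
    using False degree_diff_poly[of f] by auto
  moreover have "poly (diff_poly f) [:0, 1:] = [:poly f 0:]"
    by (simp add: poly_diff_poly pcompose_0' poly_0_coeff_0)
  ultimately show ?thesis
    using False nonzero
    by (auto simp: standard_poly_def swap_vars_diff_poly degree_content_diff_poly
        resultant_diff_poly_nonzero_iff rsquarefree_pcompose_linear_iff simp flip: g_def)
       (auto simp: g_def rsquarefree_pcompose_linear_iff)
qed

section \<open>The digraphs\<close>

text \<open>
  Simplicity of the roots makes every arc multiplicity \<open>0\<close> or \<open>1\<close>, as in a Cayley
  digraph; it also excludes \<open>f = 0\<close>.
\<close>

lemma poly_digraph_diff_poly:
  assumes "rsquarefree f"
  shows "poly_digraph (diff_poly f) = cayley_digraph {s. poly f s = 0}"
proof -
  have "arc_mult (diff_poly f) u v = (if poly f (v - u) = 0 then 1 else 0)" for u v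
  proof -
    define g where "g = pcompose f [:-u, 1:]"
    have "rsquarefree g"
      using assms by (simp add: g_def rsquarefree_pcompose_linear_iff[of 1, simplified])
    moreover have "poly g v = poly f (v - u)"
      by (simp add: g_def poly_pcompose)
    ultimately show ?thesis
      using rsquarefree_root_order[of g v] order_0I[of g v]
      unfolding arc_mult_def specialize_x_diff_poly g_def[symmetric] rsquarefree_def by metis
  qed
  moreover have "poly f (v - u) = 0 \<longleftrightarrow> (\<exists>s\<in>{s. poly f s = 0}. v = s + u)" for u v
    by (auto simp: algebra_simps intro: bexI[of _ "v - u"])
  ultimately show ?thesis
    by (auto simp: poly_digraph_def cayley_digraph_def split: if_splits)
qed

lemma wf_digraph_cayley_digraph: "wf_digraph (cayley_digraph S)"
  by unfold_locales (auto simp: cayley_digraph_def)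

lemma digraph_iso_refl:
  assumes "wf_digraph G"
  shows "digraph_iso G G"
  unfolding digraph_iso_def
proof (intro exI conjI)
  let ?id = "\<lparr>iso_verts = id, iso_arcs = id, iso_head = head G, iso_tail = tail G\<rparr>"
  show "pre_digraph.digraph_isomorphism G ?id"
    using assms by (simp add: pre_digraph.digraph_isomorphism_def)
  show "G = app_iso ?id G"
    by (simp add: app_iso_def)
qed

lemma exists_rsquarefree_poly_with_roots:
  fixes S :: "complex set"
  assumes "finite S"
  obtains f where "rsquarefree f" "{s. poly f s = 0} = S"
proof
  let ?f = "\<Prod>s\<in>S. [:-s, 1:]"
  show "{s. poly ?f s = 0} = S"
    using assms by (auto simp: poly_prod)
  have order_linear: "order a [:-s, 1:] = (if a = s then 1 else 0)" for a s :: complex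
    using order_power_n_n[of a 1] by (auto intro: order_0I)
  have "order a ?f = (if a \<in> S then 1 else 0)" for a
    using assms
    by (induction S rule: finite_induct) (auto simp: order_mult order_linear[simplified] simp del: mult_pCons_left)
  thus "rsquarefree ?f"
    using assms by (auto simp: rsquarefree_def)
qed

theorem theorem4:
  shows "(\<forall>(\<Phi> :: complex poly poly) (f :: complex poly).
            standard_poly \<Phi> \<and> \<Phi> = diff_poly f \<longrightarrow>
            (\<exists>S :: complex set. finite S \<and> S \<noteq> {} \<and> 0 \<notin> S \<and>
               poly_digraph \<Phi> = cayley_digraph S))
       \<and> (\<forall>S :: complex set. finite S \<and> S \<noteq> {} \<and> 0 \<notin> S \<longrightarrow>
            (\<exists>f :: complex poly. standard_poly (diff_poly f) \<and>
               digraph_iso (cayley_digraph S) (poly_digraph (diff_poly f))))"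
proof (intro conjI allI impI)
  fix \<Phi> :: "complex poly poly" and f
  assume "standard_poly \<Phi> \<and> \<Phi> = diff_poly f"
  hence \<Phi>: "\<Phi> = diff_poly f" and f: "degree f > 0" "rsquarefree f" "poly f 0 \<noteq> 0"
    by (auto simp: standard_diff_poly_iff)
  let ?S = "{s. poly f s = 0}"
  have "finite ?S"
    using f by (intro poly_roots_finite) auto
  moreover have "?S \<noteq> {}"
    using f fundamental_theorem_of_algebra[of f] by (auto simp: constant_degree)
  ultimately show "\<exists>S. finite S \<and> S \<noteq> {} \<and> 0 \<notin> S \<and> poly_digraph \<Phi> = cayley_digraph S"
    using f poly_digraph_diff_poly[OF f(2)] \<Phi> by (intro exI[of _ ?S]) auto
next
  fix S :: "complex set"
  assume S: "finite S \<and> S \<noteq> {} \<and> 0 \<notin> S"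
  then obtain f where f: "rsquarefree f" "{s. poly f s = 0} = S"
    using exists_rsquarefree_poly_with_roots by blast
  have "degree f > 0"
  proof (rule ccontr)
    assume "\<not> degree f > 0"
    then obtain c where "f = [:c:]"
      by (auto elim: degree_eq_zeroE)
    with f S show False by (auto simp: rsquarefree_def)
  qed
  hence "standard_poly (diff_poly f)"
    using f S by (auto simp: standard_diff_poly_iff)
  moreover have "digraph_iso (cayley_digraph S) (poly_digraph (diff_poly f))"
    using poly_digraph_diff_poly[OF f(1)] f(2) digraph_iso_refl[OF wf_digraph_cayley_digraph]
    by simp
  ultimately show "\<exists>f. standard_poly (diff_poly f) \<and>
      digraph_iso (cayley_digraph S) (poly_digraph (diff_poly f))"
    by blast
qed

end
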